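(* Let $k\ge1$ and $l\ge1$ be integers and put $\varphi=\max\{k,l-1\}$. Let $G$ be a graph of order $n$ with minimum degree $\delta\ge\varphi$, and put $b_{\varphi-1}=\binom{\delta}{\varphi-1}$. Then $$\gamma_{k,l}(G)\le\frac{\ln(\delta-\varphi+1)+\ln b_{\varphi-1}+1}{\delta-\varphi+1}\,n .$$
   Context: All graphs are finite, undirected, without loops and multiple edges (and nonempty). $N[v]$ denotes the closed neighbourhood of $v$ (the neighbours of $v$ together with $v$). For integers $k\ge1$ and $l\ge1$, a set $D\subseteq V(G)$ is a $(k,l)$-dominating set of $G$ if $|N[v]\cap D|\ge k$ for every vertex $v\notin D$ and $|N[v]\cap D|\ge l$ for every vertex $v\in D$. The parametric domination number $\gamma_{k,l}(G)$ is the minimum cardinality of a $(k,l)$-dominating set of $G$. *)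

theory Defs
  imports Complex_Main "Graph_Theory.Digraph"
begin

text \<open>
  A finite simple graph is a digraph satisfying \<^locale>\<open>graph\<close>: finite, symmetric, without
  loops and without parallel arcs, an undirected edge being a pair of opposite arcs. The degree of
  a vertex in such a digraph is its \<^const>\<open>out_degree\<close>.
\<close>

definition closed_nbhd :: "('a, 'b) pre_digraph \<Rightarrow> 'a \<Rightarrow> 'a set" where
  "closed_nbhd G v = insert v {u. (v, u) \<in> arcs_ends G}"

definition min_degree :: "('a, 'b) pre_digraph \<Rightarrow> nat" where
  "min_degree G = Min (out_degree G ` verts G)"

definition kl_dominating :: "('a, 'b) pre_digraph \<Rightarrow> nat \<Rightarrow> nat \<Rightarrow> 'a set \<Rightarrow> bool" where
  "kl_dominating G k l D \<longleftrightarrow>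
     D \<subseteq> verts G \<and>
     (\<forall>v \<in> verts G - D. k \<le> card (closed_nbhd G v \<inter> D)) \<and>
     (\<forall>v \<in> D. l \<le> card (closed_nbhd G v \<inter> D))"

text \<open>
  If the minimum degree is at least \<open>l - 1\<close>, then \<open>verts G\<close> is itself dominating, so that the
  minimum below is taken over a nonempty finite set.
\<close>

definition kl_domination_number :: "('a, 'b) pre_digraph \<Rightarrow> nat \<Rightarrow> nat \<Rightarrow> nat" where
  "kl_domination_number G k l = Min (card ` {D. kl_dominating G k l D})"

end

theory Submission
  imports Defs
begin

text \<open>
  It suffices to find a small \<open>D\<close> such that every vertex, inside or outside \<open>D\<close>, has at least
  \<open>\<phi>\<close> neighbours in \<open>D\<close>: a vertex of \<open>D\<close> counts itself as well, so \<open>l - 1\<close> neighbours are enough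
  for it, and \<open>k\<close> neighbours are enough for the others. Fix for each vertex \<open>v\<close> a set \<open>S v\<close> of
  exactly \<open>\<delta>\<close> neighbours, and put \<open>m = \<delta> - \<phi> + 1\<close>. Choose \<open>A\<close> at random, taking every vertex
  independently with probability \<open>p\<close>, and complete it by adding, for each \<open>v\<close>, as many elements of
  \<open>S v\<close> as are missing.

  The expected number of added vertices would ordinarily be a sum over the possible values of
  \<open>card (A \<inter> S v)\<close>. Counting avoidance events replaces that sum: the number of vertices missing at
  \<open>v\<close> is at most the number of subsets \<open>T\<close> of \<open>S v\<close> of size \<open>\<phi> - 1\<close> such that \<open>A\<close> misses the
  other \<open>m\<close> elements of \<open>S v\<close> (\<open>deficiency_le_card_avoided_subsets\<close>). There are
  \<open>b = \<delta> choose (\<phi> - 1)\<close> candidates \<open>T\<close>, and each has this property with probability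
  \<open>(1 - p) ^ m\<close>. Hence some \<open>D\<close> has at most \<open>(p + b * (1 - p) ^ m) * n\<close> elements
  (\<open>exists_multiple_transversal\<close>).

  Since \<open>(1 - p) ^ m \<le> exp (- p * m)\<close>, the choice \<open>p = (ln m + ln b) / m\<close>, the minimiser of
  \<open>p + b * exp (- p * m)\<close>, makes the second term at most \<open>1 / m\<close> and gives the claim.
  If this \<open>p\<close> exceeds \<open>1\<close>, then the claimed bound exceeds \<open>n\<close>, and the set of all vertices
  will do.
\<close>

section \<open>Averaging over random subsets\<close>

text \<open>
  This is the probability that a random subset of \<open>V\<close>, containing each element independently with
  probability \<open>p\<close>, equals \<open>A\<close>; expectations are weighted sums over \<open>Pow V\<close>.
\<close>

definition subset_weight :: "real \<Rightarrow> 'a set \<Rightarrow> 'a set \<Rightarrow> real" where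
  "subset_weight p V A = p ^ card A * (1 - p) ^ card (V - A)"

lemma sum_subset_weight:
  assumes "finite V"
  shows "(\<Sum>A\<in>Pow V. subset_weight p V A) = 1"
proof -
  have "(\<Sum>A\<in>Pow V. subset_weight p V A) = (\<Prod>x\<in>V. p + (1 - p))"
    unfolding subset_weight_def prod_add[OF assms] by simp
  then show ?thesis by simp
qed

text \<open>
  The probability of avoiding \<open>U\<close> is the only probability that the argument needs; all the
  expectations below reduce to it by linearity.
\<close>

lemma sum_subset_weight_disjoint:
  assumes "finite V" and "U \<subseteq> V"
  shows "(\<Sum>A\<in>Pow V. subset_weight p V A * of_bool (A \<inter> U = {})) = (1 - p) ^ card U"
proof -
  have fin: "finite U" using assms finite_subset by blast
  have factor: "subset_weight p V A = (1 - p) ^ card U * subset_weight p (V - U) A"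
    if "A \<subseteq> V - U" for A
  proof -
    have "V - A = U \<union> (V - U - A)" using that assms(2) by blast
    then have "card (V - A) = card U + card (V - U - A)"
      using fin assms(1) by (simp add: card_Un_disjoint Int_Diff disjoint_iff)
    then show ?thesis by (simp add: subset_weight_def power_add)
  qed
  have "(\<Sum>A\<in>Pow V. subset_weight p V A * of_bool (A \<inter> U = {}))
      = (\<Sum>A\<in>Pow (V - U). subset_weight p V A)"
    using assms(1) by (intro sum.mono_neutral_cong_right) auto
  also have "\<dots> = (1 - p) ^ card U * (\<Sum>A\<in>Pow (V - U). subset_weight p (V - U) A)"
    by (simp add: factor sum_distrib_left)
  finally show ?thesis using assms(1) by (simp add: sum_subset_weight)
qed

lemma sum_subset_weight_card:
  assumes "finite V"
  shows "(\<Sum>A\<in>Pow V. subset_weight p V A * real (card A)) = p * real (card V)"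
proof -
  have card_eq: "real (card A) = (\<Sum>v\<in>V. 1 - of_bool (A \<inter> {v} = {}))" if "A \<subseteq> V" for A
  proof -
    have "real (card A) = (\<Sum>v\<in>A. 1)" by simp
    also have "\<dots> = (\<Sum>v\<in>V. 1 - of_bool (A \<inter> {v} = {}))"
      using assms that by (intro sum.mono_neutral_cong_left) auto
    finally show ?thesis .
  qed
  have "(\<Sum>A\<in>Pow V. subset_weight p V A * real (card A))
      = (\<Sum>A\<in>Pow V. \<Sum>v\<in>V. subset_weight p V A * (1 - of_bool (A \<inter> {v} = {})))"
    by (intro sum.cong refl) (simp add: card_eq sum_distrib_left)
  also have "\<dots> = (\<Sum>v\<in>V. \<Sum>A\<in>Pow V. subset_weight p V A * (1 - of_bool (A \<inter> {v} = {})))"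
    by (rule sum.swap)
  also have "\<dots> = (\<Sum>v\<in>V. p)"
  proof (intro sum.cong refl)
    fix v assume "v \<in> V"
    have "(\<Sum>A\<in>Pow V. subset_weight p V A * (1 - of_bool (A \<inter> {v} = {})))
        = (\<Sum>A\<in>Pow V. subset_weight p V A)
          - (\<Sum>A\<in>Pow V. subset_weight p V A * of_bool (A \<inter> {v} = {}))"
      unfolding right_diff_distrib by (simp add: sum_subtractf)
    also have "\<dots> = p"
      using \<open>v \<in> V\<close> assms
      by (subst sum_subset_weight, simp, subst sum_subset_weight_disjoint) auto
    finally show "(\<Sum>A\<in>Pow V. subset_weight p V A * (1 - of_bool (A \<inter> {v} = {}))) = p" .
  qed
  finally show ?thesis by simp
qed

lemma exists_subset_le_average:
  assumes "finite V" and "0 \<le> p" and "p \<le> 1"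
  obtains A where "A \<subseteq> V" and "F A \<le> (\<Sum>A\<in>Pow V. subset_weight p V A * F A)"
proof -
  obtain A where A: "A \<in> Pow V" "\<And>B. B \<in> Pow V \<Longrightarrow> F A \<le> F B"
    using arg_min_if_finite(1)[of "Pow V" F] arg_min_least[of "Pow V" _ F]
      assms(1) by (metis Pow_not_empty finite_Pow_iff)
  have "F A = (\<Sum>B\<in>Pow V. subset_weight p V B * F A)"
    by (simp add: sum_subset_weight[OF assms(1)] flip: sum_distrib_right)
  also have "\<dots> \<le> (\<Sum>B\<in>Pow V. subset_weight p V B * F B)"
    using A(2) assms(2,3) by (intro sum_mono mult_left_mono) (auto simp: subset_weight_def)
  finally show ?thesis using that A(1) by blast
qed

section \<open>Completing a set so that every vertex has enough neighbours\<close>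

text \<open>
  These are the \<open>T\<close> of size \<open>j\<close> with \<open>A \<inter> S \<subseteq> T \<subseteq> S\<close>. The condition is phrased as
  the avoidance of \<open>S - T\<close>, an event whose probability depends only on \<open>card S - j\<close>.
\<close>

definition avoided_subsets :: "nat \<Rightarrow> 'a set \<Rightarrow> 'a set \<Rightarrow> 'a set set" where
  "avoided_subsets j S A = {T. T \<subseteq> S \<and> card T = j \<and> A \<inter> (S - T) = {}}"

text \<open>
  If \<open>A\<close> has fewer than \<open>\<phi>\<close> elements in \<open>S\<close>, enlarge \<open>A \<inter> S\<close> to some \<open>Q \<subseteq> S\<close> with \<open>\<phi>\<close> elements.
  Removing any one of the \<open>\<phi> - card (A \<inter> S)\<close> new elements from \<open>Q\<close> leaves a set \<open>T\<close> as counted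
  on the right, and different elements leave different sets.
\<close>

lemma deficiency_le_card_avoided_subsets:
  assumes "finite S" and "\<phi> \<le> card S"
  shows "\<phi> - card (A \<inter> S) \<le> card (avoided_subsets (\<phi> - 1) S A)"
proof (cases "card (A \<inter> S) < \<phi>")
  case True
  then obtain Q where Q: "A \<inter> S \<subseteq> Q" "Q \<subseteq> S" "card Q = \<phi>"
    using exists_subset_between[of "A \<inter> S" \<phi> S] assms by auto
  have finQ: "finite Q" using Q(2) assms(1) finite_subset by blast
  have "\<phi> - card (A \<inter> S) = card (Q - A \<inter> S)"
    using Q finQ by (simp add: card_Diff_subset finite_subset)
  also have "\<dots> \<le> card (avoided_subsets (\<phi> - 1) S A)"
  proof (rule card_inj_on_le)
    show "inj_on (\<lambda>x. Q - {x}) (Q - A \<inter> S)" by (auto simp: inj_on_def)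
    show "(\<lambda>x. Q - {x}) ` (Q - A \<inter> S) \<subseteq> avoided_subsets (\<phi> - 1) S A"
      using Q finQ unfolding avoided_subsets_def by auto
    show "finite (avoided_subsets (\<phi> - 1) S A)"
      using assms(1) unfolding avoided_subsets_def by simp
  qed
  finally show ?thesis .
qed simp

text \<open>
  The sets added for the different \<open>v\<close> may overlap, so the sum of the deficiencies bounds the cost of
  completing \<open>A\<close>.
\<close>

lemma exists_completion:
  assumes "finite V" and "\<And>v. v \<in> V \<Longrightarrow> S v \<subseteq> V" and "\<And>v. v \<in> V \<Longrightarrow> \<phi> \<le> card (S v)"
    and "A \<subseteq> V"
  obtains D where "D \<subseteq> V" and "\<And>v. v \<in> V \<Longrightarrow> \<phi> \<le> card (S v \<inter> D)"
    and "card D \<le> card A + (\<Sum>v\<in>V. card (avoided_subsets (\<phi> - 1) (S v) A))"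
proof -
  have finS: "finite (S v)" if "v \<in> V" for v using assms(1,2) that finite_subset by blast
  have "\<exists>E. E \<subseteq> S v - A \<and> card E = \<phi> - card (A \<inter> S v)" if "v \<in> V" for v
  proof -
    have "card (S v - A) = card (S v) - card (A \<inter> S v)"
      using finS[OF that] by (simp add: card_Diff_subset_Int Int_commute)
    then have "\<phi> - card (A \<inter> S v) \<le> card (S v - A)" using assms(3)[OF that] by simp
    then show ?thesis using obtain_subset_with_card_n by metis
  qed
  then obtain E where E: "\<And>v. v \<in> V \<Longrightarrow> E v \<subseteq> S v - A"
      "\<And>v. v \<in> V \<Longrightarrow> card (E v) = \<phi> - card (A \<inter> S v)"
    by metis
  define D where "D = A \<union> (\<Union>v\<in>V. E v)"
  have sub: "D \<subseteq> V" using E(1) assms(2,4) unfolding D_def by blast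
  have enough: "\<phi> \<le> card (S v \<inter> D)" if v: "v \<in> V" for v
  proof -
    have "\<phi> \<le> card (A \<inter> S v) + card (E v)" using E(2)[OF v] by simp
    also have "\<dots> = card (A \<inter> S v \<union> E v)"
      using E(1)[OF v] finS[OF v] by (intro card_Un_disjoint[symmetric]) (auto intro: finite_subset)
    also have "\<dots> \<le> card (S v \<inter> D)"
      using E(1)[OF v] finS[OF v] v by (intro card_mono) (auto simp: D_def)
    finally show ?thesis .
  qed
  have "card D \<le> card A + card (\<Union>v\<in>V. E v)" unfolding D_def by (rule card_Un_le)
  also have "card (\<Union>v\<in>V. E v) \<le> (\<Sum>v\<in>V. card (E v))" using assms(1) by (rule card_UN_le)
  also have "\<dots> \<le> (\<Sum>v\<in>V. card (avoided_subsets (\<phi> - 1) (S v) A))"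
  proof (rule sum_mono)
    fix v assume v: "v \<in> V"
    show "card (E v) \<le> card (avoided_subsets (\<phi> - 1) (S v) A)"
      unfolding E(2)[OF v]
      by (rule deficiency_le_card_avoided_subsets[OF finS[OF v] assms(3)[OF v]])
  qed
  finally show ?thesis using that sub enough by simp
qed

lemma sum_subset_weight_avoided_subsets:
  assumes "finite V" and "S \<subseteq> V"
  shows "(\<Sum>A\<in>Pow V. subset_weight p V A * real (card (avoided_subsets j S A)))
    = real (card S choose j) * (1 - p) ^ (card S - j)"
proof -
  define \<T> where "\<T> = {T. T \<subseteq> S \<and> card T = j}"
  have finS: "finite S" using assms finite_subset by blast
  then have fin: "finite \<T>" unfolding \<T>_def by simp
  have card_eq: "real (card (avoided_subsets j S A)) = (\<Sum>T\<in>\<T>. of_bool (A \<inter> (S - T) = {}))" for A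
  proof -
    have "avoided_subsets j S A = \<T> \<inter> {T. A \<inter> (S - T) = {}}"
      unfolding avoided_subsets_def \<T>_def by blast
    then show ?thesis using fin by simp
  qed
  have "(\<Sum>A\<in>Pow V. subset_weight p V A * real (card (avoided_subsets j S A)))
      = (\<Sum>T\<in>\<T>. \<Sum>A\<in>Pow V. subset_weight p V A * of_bool (A \<inter> (S - T) = {}))"
    unfolding card_eq sum_distrib_left by (rule sum.swap)
  also have "\<dots> = (\<Sum>T\<in>\<T>. (1 - p) ^ (card S - j))"
  proof (intro sum.cong refl)
    fix T assume T: "T \<in> \<T>"
    then have "card (S - T) = card S - j"
      using finS unfolding \<T>_def by (auto simp: card_Diff_subset finite_subset)
    moreover have "S - T \<subseteq> V" using assms(2) by blast
    ultimately show "(\<Sum>A\<in>Pow V. subset_weight p V A * of_bool (A \<inter> (S - T) = {}))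
        = (1 - p) ^ (card S - j)"
      using sum_subset_weight_disjoint[OF assms(1)] by metis
  qed
  also have "\<dots> = real (card S choose j) * (1 - p) ^ (card S - j)"
    using n_subsets[OF finS] by (simp add: \<T>_def)
  finally show ?thesis .
qed

text \<open>
  The quantity to average is the bound on the size of the completion of \<open>A\<close>. The exponent is
  \<open>\<delta> - \<phi> + 1\<close> when \<open>\<phi>\<close> is positive.
\<close>

lemma exists_multiple_transversal:
  assumes "finite V" and "\<And>v. v \<in> V \<Longrightarrow> S v \<subseteq> V" and "\<And>v. v \<in> V \<Longrightarrow> card (S v) = \<delta>"
    and "\<phi> \<le> \<delta>" and "0 \<le> p" and "p \<le> 1"
  obtains D where "D \<subseteq> V" and "\<And>v. v \<in> V \<Longrightarrow> \<phi> \<le> card (S v \<inter> D)"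
    and "real (card D)
      \<le> (p + real (\<delta> choose (\<phi> - 1)) * (1 - p) ^ (\<delta> - (\<phi> - 1))) * real (card V)"
proof -
  define F where
    "F A = real (card A) + (\<Sum>v\<in>V. real (card (avoided_subsets (\<phi> - 1) (S v) A)))" for A
  obtain A where A: "A \<subseteq> V" "F A \<le> (\<Sum>A\<in>Pow V. subset_weight p V A * F A)"
    using exists_subset_le_average[OF assms(1,5,6)] by blast
  obtain D where D: "D \<subseteq> V" "\<And>v. v \<in> V \<Longrightarrow> \<phi> \<le> card (S v \<inter> D)"
      "card D \<le> card A + (\<Sum>v\<in>V. card (avoided_subsets (\<phi> - 1) (S v) A))"
    using exists_completion[of V S \<phi> A] assms A(1) by metis
  have "real (card D) \<le> F A"
    using D(3) unfolding F_def by (simp flip: of_nat_sum of_nat_add)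
  also note A(2)
  also have "(\<Sum>A\<in>Pow V. subset_weight p V A * F A) = p * real (card V)
      + (\<Sum>v\<in>V. \<Sum>A\<in>Pow V. subset_weight p V A * real (card (avoided_subsets (\<phi> - 1) (S v) A)))"
    unfolding F_def distrib_left sum.distrib sum_subset_weight_card[OF assms(1)] sum_distrib_left
    by (subst sum.swap) (rule refl)
  also have "\<dots> = (p + real (\<delta> choose (\<phi> - 1)) * (1 - p) ^ (\<delta> - (\<phi> - 1))) * real (card V)"
    using assms(1-3) by (simp add: sum_subset_weight_avoided_subsets algebra_simps)
  finally show ?thesis using that D(1,2) by blast
qed

lemma exists_multiple_transversal_log_bound:
  fixes m b :: real
  assumes "finite V" and "\<And>v. v \<in> V \<Longrightarrow> S v \<subseteq> V" and "\<And>v. v \<in> V \<Longrightarrow> card (S v) = \<delta>"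
    and "1 \<le> \<phi>" and "\<phi> \<le> \<delta>"
  defines "m \<equiv> real \<delta> - real \<phi> + 1" and "b \<equiv> real (\<delta> choose (\<phi> - 1))"
  obtains D where "D \<subseteq> V" and "\<And>v. v \<in> V \<Longrightarrow> \<phi> \<le> card (S v \<inter> D)"
    and "real (card D) \<le> (ln m + ln b + 1) / m * real (card V)"
proof -
  have m: "1 \<le> m" "m = real (\<delta> - (\<phi> - 1))" using assms(4,5) by (auto simp: m_def)
  have "0 < \<delta> choose (\<phi> - 1)" using assms(5) by (simp add: zero_less_binomial)
  then have b: "1 \<le> b" unfolding b_def by linarith
  \<comment> \<open>The minimiser of \<open>p + b * exp (- p * m)\<close>; there the second summand equals \<open>1 / m\<close>.\<close>
  define p where "p = (ln m + ln b) / m"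
  have bound: "(ln m + ln b + 1) / m = p + 1 / m" by (simp add: p_def add_divide_distrib)
  have p0: "0 \<le> p" using m(1) b by (simp add: p_def)
  show ?thesis
  proof (cases "p \<le> 1")
    case True
    obtain D where D: "D \<subseteq> V" "\<And>v. v \<in> V \<Longrightarrow> \<phi> \<le> card (S v \<inter> D)"
      "real (card D) \<le> (p + b * (1 - p) ^ (\<delta> - (\<phi> - 1))) * real (card V)"
      unfolding b_def
      by (rule exists_multiple_transversal[where S = S, OF assms(1) _ _ assms(5) p0 True])
        (use assms(2,3) in blast)+
    have "(1 - p) ^ (\<delta> - (\<phi> - 1)) \<le> exp (- p) ^ (\<delta> - (\<phi> - 1))"
      using True exp_ge_add_one_self[of "- p"] by (intro power_mono) auto
    also have "\<dots> = exp (- (ln m + ln b))"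
      using m by (simp add: p_def flip: exp_of_nat_mult)
    also have "\<dots> = 1 / (m * b)" using m(1) b by (simp add: exp_diff exp_minus field_simps)
    finally have "b * (1 - p) ^ (\<delta> - (\<phi> - 1)) \<le> 1 / m" using m(1) b by (simp add: field_simps)
    then have "(p + b * (1 - p) ^ (\<delta> - (\<phi> - 1))) * real (card V) \<le> (p + 1 / m) * real (card V)"
      by (intro mult_right_mono) auto
    then show ?thesis using that D bound by force
  next
    case False
    show ?thesis
    proof (rule that[of V])
      show "\<phi> \<le> card (S v \<inter> V)" if "v \<in> V" for v
        using assms(2,3,5) that by (simp add: Int_absorb2)
      have "1 * real (card V) \<le> (p + 1 / m) * real (card V)"
        using False m(1) by (intro mult_right_mono) (auto intro: add_increasing2)
      then show "real (card V) \<le> (ln m + ln b + 1) / m * real (card V)" by (simp add: bound)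
    qed simp
  qed
qed

section \<open>Parametric domination in graphs\<close>

definition neighbours :: "('a, 'b) pre_digraph \<Rightarrow> 'a \<Rightarrow> 'a set" where
  "neighbours G v = {u. (v, u) \<in> arcs_ends G}"

lemma neighbours_subset_verts:
  assumes "wf_digraph G"
  shows "neighbours G v \<subseteq> verts G"
  using assms by (auto simp: neighbours_def arcs_ends_def arc_to_ends_def wf_digraph_def)

lemma min_degree_le_card_neighbours:
  assumes "Digraph.graph G" and "v \<in> verts G"
  shows "min_degree G \<le> card (neighbours G v)"
proof -
  interpret Digraph.graph G by (rule assms(1))
  have "neighbours G v = head G ` out_arcs G v"
    by (force simp: neighbours_def arcs_ends_def arc_to_ends_def out_arcs_def)
  moreover have "inj_on (head G) (out_arcs G v)"
    using no_multi_arcs by (auto simp: inj_on_def arc_to_ends_def out_arcs_def)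
  ultimately have "card (neighbours G v) = out_degree G v"
    by (simp add: card_image out_degree_def)
  then show ?thesis using assms(2) by (simp add: min_degree_def)
qed

text \<open>
  Counting open neighbourhoods turns the two thresholds into one: a vertex of \<open>D\<close> lies in its own
  closed neighbourhood and therefore needs only \<open>l - 1\<close> neighbours in \<open>D\<close>.
\<close>

lemma kl_dominating_if_neighbours:
  assumes "Digraph.graph G" and "D \<subseteq> verts G"
    and "\<And>v. v \<in> verts G \<Longrightarrow> max k (l - 1) \<le> card (neighbours G v \<inter> D)"
  shows "kl_dominating G k l D"
proof -
  interpret Digraph.graph G by (rule assms(1))
  have finN: "finite (neighbours G v)" for v
    using neighbours_subset_verts[OF wf_digraph_axioms] finite_verts finite_subset by blast
  \<comment> \<open>Without loops, \<open>v\<close> adds one to the count over its neighbours when it lies in \<open>D\<close>.\<close>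
  have notin: "v \<notin> neighbours G v" for v
    using no_loops by (auto simp: neighbours_def arcs_ends_def arc_to_ends_def)
  have nbhd: "closed_nbhd G v = insert v (neighbours G v)" for v
    by (simp add: closed_nbhd_def neighbours_def)
  have "l \<le> card (closed_nbhd G v \<inter> D)" if "v \<in> D" for v
  proof -
    have "v \<in> verts G" using that assms(2) by blast
    then have "l - 1 \<le> card (neighbours G v \<inter> D)" using assms(3)[of v] by simp
    moreover have "card (closed_nbhd G v \<inter> D) = Suc (card (neighbours G v \<inter> D))"
      using that finN notin by (simp add: nbhd)
    ultimately show ?thesis by linarith
  qed
  moreover have "k \<le> card (closed_nbhd G v \<inter> D)" if "v \<in> verts G - D" for v
    using assms(3)[of v] that by (simp add: nbhd)
  ultimately show ?thesis using assms(2) by (simp add: kl_dominating_def)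
qed

lemma kl_domination_number_le:
  assumes "finite (verts G)" and "kl_dominating G k l D"
  shows "kl_domination_number G k l \<le> card D"
proof -
  have "{D. kl_dominating G k l D} \<subseteq> Pow (verts G)" by (auto simp: kl_dominating_def)
  then have "finite {D. kl_dominating G k l D}" using assms(1) finite_subset by blast
  then show ?thesis using assms(2) by (auto simp: kl_domination_number_def)
qed

theorem corollary2:
  fixes G :: "('a, 'b) pre_digraph" and k l \<phi> n \<delta> b :: nat
  assumes "1 \<le> k" and "1 \<le> l"
    and "\<phi> = max k (l - 1)"
    and "Digraph.graph G" and "verts G \<noteq> {}"
    and "n = card (verts G)"
    and "\<delta> = min_degree G" and "\<phi> \<le> \<delta>"
    and "b = \<delta> choose (\<phi> - 1)"
  shows "real (kl_domination_number G k l)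
    \<le> (ln (real \<delta> - real \<phi> + 1) + ln (real b) + 1) / (real \<delta> - real \<phi> + 1) * real n"
proof -
  interpret Digraph.graph G by (rule assms(4))
  have "\<exists>S. S \<subseteq> neighbours G v \<and> card S = \<delta>" if "v \<in> verts G" for v
    using min_degree_le_card_neighbours[OF assms(4) that] obtain_subset_with_card_n assms(7)
    by metis
  \<comment> \<open>Sets of size exactly \<open>\<delta>\<close> keep larger degrees out of the bound, where they would enlarge the
    binomial coefficient.\<close>
  then obtain S where S: "\<And>v. v \<in> verts G \<Longrightarrow> S v \<subseteq> neighbours G v"
      "\<And>v. v \<in> verts G \<Longrightarrow> card (S v) = \<delta>"
    by metis
  have subV: "neighbours G v \<subseteq> verts G" for v
    by (rule neighbours_subset_verts[OF wf_digraph_axioms])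
  have "1 \<le> \<phi>" using assms(1,3) by simp
  then obtain D where D: "D \<subseteq> verts G" "\<And>v. v \<in> verts G \<Longrightarrow> \<phi> \<le> card (S v \<inter> D)"
      "real (card D) \<le> (ln (real \<delta> - real \<phi> + 1) + ln (real b) + 1)
        / (real \<delta> - real \<phi> + 1) * real (card (verts G))"
    using exists_multiple_transversal_log_bound[of "verts G" S \<delta> \<phi>] S subV assms(8)
    unfolding assms(9) by (metis finite_verts subset_trans)
  have "\<phi> \<le> card (neighbours G v \<inter> D)" if v: "v \<in> verts G" for v
  proof -
    have "finite D" using D(1) finite_verts finite_subset by blast
    then have "card (S v \<inter> D) \<le> card (neighbours G v \<inter> D)"
      using S(1)[OF v] by (intro card_mono) auto
    then show ?thesis using D(2)[OF v] by simp
  qed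
  then have "kl_dominating G k l D"
    using D(1) assms(3) by (intro kl_dominating_if_neighbours assms(4)) auto
  then have "kl_domination_number G k l \<le> card D"
    by (rule kl_domination_number_le[OF finite_verts])
  then show ?thesis using D(3) unfolding assms(6) by simp
qed

end
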